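(* For any positive integer $k$, $$\sum_{n=1}^{\infty}\frac{\zeta(2n)}{2n\,(2n+1)\cdots(2n+2k-1)}\left(\frac{1}{2^{2n}}-\frac{1}{4^{2n}}\right) = (-1)^k\,\frac{2^{2k-2}}{\pi^{2k-1}}\,\beta(2k)+\frac{k}{(2k)!}\,\ln 2+\frac12\sum_{m=1}^{k-1}(-1)^m\,\frac{2^{2m}-1}{\pi^{2m}}\,\frac{\zeta(2m+1)}{(2k-2m-1)!}\,.$$
   Context: Here $\beta$ is the Dirichlet beta function, $\beta(s)=\sum_{j=0}^{\infty}\frac{(-1)^j}{(2j+1)^s}$ for real $s>0$, and $\zeta$ is the Riemann zeta function, $\zeta(s)=\sum_{n=1}^{\infty}\frac{1}{n^s}$ for real $s>1$. The denominator $2n(2n+1)\cdots(2n+2k-1)$ is the product of the $2k$ consecutive integers from $2n$ to $2n+2k-1$. The finite sum over $m$ from $1$ to $k-1$ is empty (equal to $0$) when $k=1$. *)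

theory Defs
  imports Complex_Main
begin

text \<open>
  Both functions are used only where their series converge: \<open>s > 0\<close> for beta
  (conditionally for \<open>s \<le> 1\<close>, so the order of summation matters) and \<open>s > 1\<close> for zeta.
\<close>

definition dirichlet_beta :: "real \<Rightarrow> real" where
  "dirichlet_beta s = (\<Sum>j. (-1) ^ j / real (2 * j + 1) powr s)"

definition zeta :: "real \<Rightarrow> real" where
  "zeta s = (\<Sum>n. 1 / real (Suc n) powr s)"

end

theory Submission
  imports Defs "HOL-Analysis.Analysis"
begin

text \<open>
  The denominators \<open>2n (2n + 1) \<dots> (2n + 2k - 1)\<close> are what \<open>2k\<close>-fold integration of \<open>x ^ (2n - 1)\<close>
  from \<open>0\<close> produces. Up to the factor \<open>4 ^ (2k - 1)\<close>, the series to be summed is therefore the value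
  at \<open>x = 1/4\<close> of the \<open>2k\<close>-fold antiderivative of
  \<open>\<Sum>n\<ge>1. \<zeta>(2n) (2 ^ (2n) - 1) x ^ (2n - 1) = (\<pi> / 2) tan (\<pi> x)\<close>. The proof computes this
  antiderivative a second time, from a Fourier series.

  Both computations start one integration up, at \<open>- ln (cos (\<pi> x)) / 2\<close>. On the power series side
  this function comes from Euler's product for the sine, whose logarithm is
  \<open>\<Sum>k. ln (1 - z\<^sup>2 / k\<^sup>2)\<close>, and from \<open>sin 2y = 2 sin y cos y\<close>
  (\<open>zeta_even_sums_ln_cos\<close>). On the Fourier side,
  \<open>- ln (2 cos (\<pi> x)) = \<Sum>m\<ge>1. (-1) ^ m cos (2 \<pi> m x) / m\<close>. This series converges only conditionally,
  so it is never used itself: \<open>cos_antideriv_1_has_derivative\<close> states that its termwise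
  antiderivative has derivative \<open>- ln (2 cos (\<pi> x))\<close> on \<open>[0, 1/4]\<close>, and is proved by Abel
  summation. All later integrations are termwise by absolute convergence.

  The two families of antiderivatives start from the same function up to the constant
  \<open>ln 2 / 2\<close>, so at every later level they differ by a polynomial, namely the Taylor polynomial built
  from their values at \<open>0\<close> (\<open>antiderivative_ladder_polynomial\<close>). The power series vanish
  at \<open>0\<close>; the Fourier series vanish there at odd levels and give the alternating zeta values
  at \<open>2m + 1\<close> at even levels. These are the zeta terms of the result, and the
  constant \<open>ln 2 / 2\<close>, integrated, is the logarithmic term. At \<open>x = 1/4\<close> the last Fourier series is a sine series with
  \<open>sin (m \<pi> / 2)\<close> in it, which leaves only odd \<open>m\<close> with alternating signs: the beta value.
\<close>

section \<open>Zeta and beta series at integer arguments\<close>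

lemma summable_Suc_inverse_power:
  fixes s :: nat assumes "s \<ge> 2" shows "summable (\<lambda>n. 1 / real (Suc n) ^ s)"
proof -
  have "summable (\<lambda>n. inverse (real n ^ s))"
    using inverse_power_summable[OF assms, where 'a=real] by simp
  then have "summable (\<lambda>n. inverse (real (Suc n) ^ s))"
    by (subst summable_Suc_iff)
  then show ?thesis by (simp add: divide_inverse)
qed

lemma zeta_sums:
  fixes s :: nat assumes "s \<ge> 2" shows "(\<lambda>n. 1 / real (Suc n) ^ s) sums zeta (real s)"
proof -
  have "zeta (real s) = (\<Sum>n. 1 / real (Suc n) ^ s)"
    unfolding zeta_def by (intro suminf_cong) (simp add: powr_realpow)
  then show ?thesis using summable_sums[OF summable_Suc_inverse_power[OF assms]] by simp
qed

lemma zeta_nonneg: "s \<ge> 2 \<Longrightarrow> zeta (real s) \<ge> 0"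
  using sums_le[OF _ sums_zero zeta_sums] by fastforce

lemma zeta_le_zeta_2:
  fixes s :: nat assumes "s \<ge> 2" shows "zeta (real s) \<le> zeta (real 2)"
proof (rule sums_le[OF _ zeta_sums[OF assms] zeta_sums[OF order_refl]])
  fix n show "1 / real (Suc n) ^ s \<le> 1 / real (Suc n) ^ 2"
    using assms by (intro divide_left_mono power_increasing) auto
qed

text \<open>
  The alternating series is the zeta series minus twice its terms with even denominators, and those
  form \<open>2 ^ (- s)\<close> times the zeta series.
\<close>
lemma alternating_zeta_sums:
  fixes s :: nat assumes "s \<ge> 2"
  shows "(\<lambda>n. (-1) ^ n / real (Suc n) ^ s) sums ((1 - 2 / 2 ^ s) * zeta (real s))"
proof -
  let ?f = "\<lambda>n. (1 - (-1) ^ n) / real (Suc n) ^ s"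
  have "(\<lambda>j. 2 / 2 ^ s * (1 / real (Suc j) ^ s)) sums (2 / 2 ^ s * zeta (real s))"
    by (intro sums_mult zeta_sums assms)
  also have "(\<lambda>j. 2 / 2 ^ s * (1 / real (Suc j) ^ s)) = (\<lambda>j. ?f (2 * j + 1))"
  proof
    fix j
    have "real (Suc (2 * j + 1)) = 2 * real (Suc j)" by simp
    then show "2 / 2 ^ s * (1 / real (Suc j) ^ s) = ?f (2 * j + 1)"
      by (simp only: power_mult_distrib) simp
  qed
  finally have "(\<lambda>j. ?f (2 * j + 1)) sums (2 / 2 ^ s * zeta (real s))" .
  moreover have "?f n = 0" if "n \<notin> range (\<lambda>j. 2 * j + 1)" for n
  proof -
    have "even n" using that by (metis oddE rangeI)
    then show ?thesis by simp
  qed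
  ultimately have "?f sums (2 / 2 ^ s * zeta (real s))"
    by (subst (asm) sums_mono_reindex) (auto simp: strict_mono_def)
  from sums_diff[OF zeta_sums[OF assms] this]
  show ?thesis by (simp add: diff_divide_distrib algebra_simps)
qed

lemma dirichlet_beta_sums:
  fixes s :: nat assumes "s \<ge> 2"
  shows "(\<lambda>j. (-1) ^ j / real (2 * j + 1) ^ s) sums dirichlet_beta (real s)"
proof -
  have "summable (\<lambda>j. (-1) ^ j / real (2 * j + 1) ^ s)"
  proof (rule summable_comparison_test'[OF summable_Suc_inverse_power[OF assms], of 0])
    fix j
    have "1 / real (2 * j + 1) ^ s \<le> 1 / real (Suc j) ^ s"
      by (intro divide_left_mono power_mono) auto
    then show "norm ((-1) ^ j / real (2 * j + 1) ^ s) \<le> 1 / real (Suc j) ^ s"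
      by (simp add: norm_divide norm_power)
  qed
  moreover have "dirichlet_beta (real s) = (\<Sum>j. (-1) ^ j / real (2 * j + 1) ^ s)"
    unfolding dirichlet_beta_def by (intro suminf_cong) (simp add: powr_realpow)
  ultimately show ?thesis by (simp add: summable_sums)
qed

section \<open>Even zeta values and the logarithm of the cosine\<close>

text \<open>
  Tonelli's theorem in the form of a double series: if the row sums can be summed, so can the column
  sums, with the same result.
\<close>
lemma sums_swap_nonneg:
  fixes f :: "nat \<Rightarrow> nat \<Rightarrow> real"
  assumes nonneg: "\<And>i j. f i j \<ge> 0"
    and rows: "\<And>i. f i sums r i" and columns: "\<And>j. (\<lambda>i. f i j) sums c j"
    and total: "r sums S"
  shows "c sums S"
proof -
  have row: "((\<lambda>j. f i j) has_sum r i) UNIV" for i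
    using rows nonneg by (intro sums_nonneg_imp_has_sum)
  have "r i \<ge> 0" for i using has_sum_nonneg[OF row] nonneg by auto
  then have tot: "(r has_sum S) UNIV" using total by (intro sums_nonneg_imp_has_sum)
  have col: "((\<lambda>i. f i j) has_sum c j) UNIV" for j
    using columns nonneg by (intro sums_nonneg_imp_has_sum)
  have "((\<lambda>(i, j). f i j) has_sum S) (UNIV \<times> UNIV)"
  proof (rule has_sum_SigmaI[where g = r])
    show "(\<lambda>(i, j). f i j) summable_on UNIV \<times> UNIV"
      using row tot nonneg by (intro summable_on_SigmaI[where g = r]) (auto simp: summable_on_def)
  qed (use row tot in auto)
  then have "((\<lambda>(j, i). f i j) has_sum S) (UNIV \<times> UNIV)"
    by (subst (asm) has_sum_swap) simp
  then have "(c has_sum S) UNIV"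
    by (rule has_sum_SigmaD) (use col in auto)
  then show ?thesis by (rule has_sum_imp_sums)
qed

text \<open>
  The logarithm of the product for \<open>sin (\<pi> z) / (\<pi> z)\<close> becomes a double series with nonnegative
  terms once each \<open>- ln (1 - z\<^sup>2 / k\<^sup>2)\<close> is expanded in powers of \<open>z\<^sup>2\<close>. Its rows are these logarithms;
  its columns collect the powers of \<open>1 / k\<close> with a fixed even exponent, that is, zeta values.
\<close>
lemma zeta_even_sums_ln_sin:
  fixes z :: real assumes z: "0 < z" "z < 1"
  shows "(\<lambda>n. zeta (real (2 * Suc n)) * z ^ (2 * Suc n) / real (Suc n))
           sums (- ln (sin (pi * z) / (pi * z)))"
proof -
  define f where "f = (\<lambda>k n. (z\<^sup>2 / real (Suc k) ^ 2) ^ Suc n / real (Suc n))"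
  have small: "z\<^sup>2 / real (Suc k) ^ 2 < 1" for k
  proof -
    have "z\<^sup>2 < 1" using z by (simp add: power_less_one_iff abs_square_less_1)
    also have "1 \<le> real (Suc k) ^ 2" by simp
    finally show ?thesis by (simp add: divide_less_eq)
  qed
  have rows: "f k sums (- ln (1 - z\<^sup>2 / real (Suc k) ^ 2))" for k
  proof -
    have "(\<lambda>n. - ((z\<^sup>2 / real (Suc k) ^ 2) ^ n) / real n) sums ln (1 - z\<^sup>2 / real (Suc k) ^ 2)"
      using ln_series'[of "- (z\<^sup>2 / real (Suc k) ^ 2)"] small[of k] by simp
    from sums_minus[OF this]
    have "(\<lambda>n. (z\<^sup>2 / real (Suc k) ^ 2) ^ n / real n) sums (- ln (1 - z\<^sup>2 / real (Suc k) ^ 2))"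
      by simp
    then show ?thesis unfolding f_def by (subst sums_Suc_iff) simp
  qed
  have columns: "(\<lambda>k. f k n) sums (zeta (real (2 * Suc n)) * z ^ (2 * Suc n) / real (Suc n))" for n
  proof -
    have "(\<lambda>k. z ^ (2 * Suc n) / real (Suc n) * (1 / real (Suc k) ^ (2 * Suc n)))
            sums (z ^ (2 * Suc n) / real (Suc n) * zeta (real (2 * Suc n)))"
      by (intro sums_mult zeta_sums) simp
    moreover have "(\<lambda>k. z ^ (2 * Suc n) / real (Suc n) * (1 / real (Suc k) ^ (2 * Suc n))) = (\<lambda>k. f k n)"
      unfolding f_def power_divide power_mult[symmetric] by (simp add: mult.commute)
    ultimately show ?thesis by (simp add: mult.commute)
  qed
  have sin_pos: "sin (pi * z) > 0" using z by (intro sin_gt_zero) auto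
  have "(\<lambda>N. \<Prod>k = 1..N. 1 - z\<^sup>2 / real k ^ 2) \<longlonglongrightarrow> sin (pi * z) / (pi * z)"
    using sin_product_formula_real'[of z] z by simp
  then have "(\<lambda>N. ln (\<Prod>k = 1..N. 1 - z\<^sup>2 / real k ^ 2)) \<longlonglongrightarrow> ln (sin (pi * z) / (pi * z))"
    using z sin_pos by (intro tendsto_ln) auto
  moreover have "ln (\<Prod>k = 1..N. 1 - z\<^sup>2 / real k ^ 2) = (\<Sum>k<N. ln (1 - z\<^sup>2 / real (Suc k) ^ 2))" for N
  proof -
    have "(\<Prod>k = 1..N. 1 - z\<^sup>2 / real k ^ 2) = (\<Prod>k<N. 1 - z\<^sup>2 / real (Suc k) ^ 2)"
      by (rule prod.reindex_bij_witness[of _ Suc "\<lambda>k. k - 1"]) auto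
    moreover have "1 - z\<^sup>2 / real (Suc k) ^ 2 \<noteq> 0" "1 - z\<^sup>2 / real (Suc k) ^ 2 > 0" for k
      using small[of k] by simp_all
    ultimately show ?thesis by (simp add: ln_prod del: of_nat_Suc)
  qed
  ultimately have "(\<lambda>k. ln (1 - z\<^sup>2 / real (Suc k) ^ 2)) sums ln (sin (pi * z) / (pi * z))"
    by (simp add: sums_def)
  then have "(\<lambda>k. - ln (1 - z\<^sup>2 / real (Suc k) ^ 2)) sums (- ln (sin (pi * z) / (pi * z)))"
    by (rule sums_minus)
  from sums_swap_nonneg[OF _ rows columns this] show ?thesis
    unfolding f_def by simp
qed

text \<open>
  The difference of the previous expansion at \<open>2x\<close> and at \<open>x\<close>, by the duplication formula for the sine.
\<close>
lemma zeta_even_sums_ln_cos: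
  fixes x :: real assumes x: "0 \<le> x" "x < 1/2"
  shows "(\<lambda>n. zeta (real (2 * Suc n)) * (2 ^ (2 * Suc n) - 1) * x ^ (2 * Suc n) / real (2 * Suc n))
           sums (- ln (cos (pi * x)) / 2)"
proof (cases "x = 0")
  case True then show ?thesis by simp
next
  case False
  with x have x: "0 < x" "x < 1/2" by auto
  have s: "sin (pi * x) > 0" "sin (pi * (2 * x)) > 0"
    using x by (auto intro!: sin_gt_zero)
  have c: "cos (pi * x) > 0" using x by (intro cos_gt_zero) auto
  have "sin (pi * (2 * x)) / (pi * (2 * x)) = cos (pi * x) * (sin (pi * x) / (pi * x))"
    using sin_double[of "pi * x"] x by (simp add: field_simps)
  then have "ln (sin (pi * (2 * x)) / (pi * (2 * x))) - ln (sin (pi * x) / (pi * x)) = ln (cos (pi * x))"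
    using s c x by (simp add: ln_mult ln_div)
  moreover have "(\<lambda>n. (zeta (real (2 * Suc n)) * (2 * x) ^ (2 * Suc n) / real (Suc n)
        - zeta (real (2 * Suc n)) * x ^ (2 * Suc n) / real (Suc n)) / 2) sums
      ((- ln (sin (pi * (2 * x)) / (pi * (2 * x))) - - ln (sin (pi * x) / (pi * x))) / 2)"
    using x by (intro sums_divide sums_diff zeta_even_sums_ln_sin) auto
  moreover have "(zeta (real (2 * Suc n)) * (2 * x) ^ (2 * Suc n) / real (Suc n)
        - zeta (real (2 * Suc n)) * x ^ (2 * Suc n) / real (Suc n)) / 2 =
      zeta (real (2 * Suc n)) * (2 ^ (2 * Suc n) - 1) * x ^ (2 * Suc n) / real (2 * Suc n)" for n
  proof -
    have "real (2 * Suc n) = 2 * real (Suc n)" by simp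
    moreover have "(a * (b * c) / d - a * c / d) / 2 = a * (b - 1) * c / (2 * d)" for a b c d :: real
      by (simp add: field_simps diff_divide_distrib)
    ultimately show ?thesis by (simp only: power_mult_distrib)
  qed
  ultimately show ?thesis by (simp only:) (simp only: minus_diff_minus minus_divide_left)
qed

section \<open>Iterated antiderivatives of the tangent as power series\<close>

text \<open>
  The \<open>i\<close>-th derivative at \<open>0\<close> of \<open>(\<pi> / 2) tan (\<pi> x)\<close>.
\<close>
definition tan_coeff :: "nat \<Rightarrow> real" where
  "tan_coeff i = (if odd i then zeta (real (Suc i)) * (2 ^ Suc i - 1) * fact i else 0)"

text \<open>
  In the normalisation \<open>\<Sum>i. b i * x ^ i / fact i\<close>, taking the antiderivative that vanishes at \<open>0\<close> is
  a shift of the sequence \<open>b\<close>; here it is shifted \<open>p\<close> times.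
\<close>
definition tan_antideriv_coeff :: "nat \<Rightarrow> nat \<Rightarrow> real" where
  "tan_antideriv_coeff p i = (if i < p then 0 else tan_coeff (i - p) / fact i)"

definition tan_antideriv :: "nat \<Rightarrow> real \<Rightarrow> real" where
  "tan_antideriv p x = (\<Sum>i. tan_antideriv_coeff p i * x ^ i)"

text \<open>
  This crude bound, uniform in \<open>p\<close>, gives convergence for \<open>\<bar>x\<bar> < 1/2\<close>, which covers the
  point \<open>1/4\<close> with room to differentiate.
\<close>
lemma tan_antideriv_coeff_bound: "\<bar>tan_antideriv_coeff p i\<bar> \<le> zeta (real 2) * (2 * 2 ^ i)"
proof (cases "i < p \<or> even (i - p)")
  case True
  then show ?thesis using zeta_nonneg[of 2] by (auto simp: tan_antideriv_coeff_def tan_coeff_def)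
next
  case False
  define j where "j = i - p"
  have j: "odd j" "j \<le> i" and ge: "Suc j \<ge> 2" and c: "tan_antideriv_coeff p i = tan_coeff j / fact i"
    using False odd_pos[of "i - p"] by (auto simp: j_def tan_antideriv_coeff_def simp del: even_diff_nat)
  have "fact j \<le> (fact i :: real)" using j by (intro fact_mono)
  then have q: "fact j / fact i \<le> (1::real)" by (simp add: divide_le_eq)
  have "\<bar>tan_antideriv_coeff p i\<bar> = zeta (real (Suc j)) * (2 ^ Suc j - 1) * (fact j / fact i)"
    using zeta_nonneg[OF ge] j one_le_power[of "2::real" "Suc j"]
    by (simp add: c tan_coeff_def abs_mult del: power_Suc)
  also have "\<dots> \<le> zeta (real 2) * (2 * 2 ^ i) * 1"
  proof (intro mult_mono)
    have "(2::real) ^ j \<le> 2 ^ i" using j by simp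
    then show "(2::real) ^ Suc j - 1 \<le> 2 * 2 ^ i" unfolding power_Suc by linarith
  qed (use q zeta_nonneg[of 2] zeta_le_zeta_2[OF ge] zeta_nonneg[OF ge] in \<open>auto simp del: power_Suc\<close>)
  finally show ?thesis by simp
qed

lemma tan_antideriv_summable:
  assumes "\<bar>x\<bar> < 1/2" shows "summable (\<lambda>i. tan_antideriv_coeff p i * x ^ i)"
proof (rule summable_comparison_test'[of _ 0])
  show "summable (\<lambda>i. zeta (real 2) * 2 * (2 * \<bar>x\<bar>) ^ i)"
    using assms by (intro summable_mult summable_geometric) auto
  fix i
  have "norm (tan_antideriv_coeff p i * x ^ i) \<le> zeta (real 2) * (2 * 2 ^ i) * \<bar>x\<bar> ^ i"
    using tan_antideriv_coeff_bound[of p i] by (simp add: abs_mult power_abs mult_right_mono)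
  then show "norm (tan_antideriv_coeff p i * x ^ i) \<le> zeta (real 2) * 2 * (2 * \<bar>x\<bar>) ^ i"
    by (simp add: power_mult_distrib mult_ac)
qed

lemma tan_antideriv_has_derivative:
  assumes "\<bar>x\<bar> < 1/2"
  shows "(tan_antideriv (Suc p) has_real_derivative tan_antideriv p x) (at x)"
proof -
  obtain K where K: "\<bar>x\<bar> < K" "K < 1/2" using assms dense by blast
  have "summable (\<lambda>i. tan_antideriv_coeff (Suc p) i * K ^ i)"
    using K by (intro tan_antideriv_summable) auto
  from termdiffs_strong[OF this, of x]
  have "((\<lambda>x. \<Sum>i. tan_antideriv_coeff (Suc p) i * x ^ i) has_real_derivative
          (\<Sum>i. diffs (tan_antideriv_coeff (Suc p)) i * x ^ i)) (at x)"
    using K by simp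
  moreover have "diffs (tan_antideriv_coeff (Suc p)) = tan_antideriv_coeff p"
    by (rule ext) (simp add: diffs_def tan_antideriv_coeff_def field_simps del: of_nat_Suc)
  ultimately show ?thesis by (simp add: tan_antideriv_def[abs_def])
qed

lemma tan_antideriv_0: "p > 0 \<Longrightarrow> tan_antideriv p 0 = 0"
  by (simp add: tan_antideriv_def powser_zero tan_antideriv_coeff_def)

text \<open>
  Only the exponents \<open>2n + 1 + p\<close> occur in the series. The quotient of factorials is the reciprocal of
  the product of the \<open>p\<close> consecutive integers from \<open>2n + 2\<close> to \<open>2n + 1 + p\<close>.
\<close>
lemma tan_antideriv_sums:
  assumes "\<bar>x\<bar> < 1/2"
  shows "(\<lambda>n. zeta (real (2 * Suc n)) * (2 ^ (2 * Suc n) - 1) * fact (2 * n + 1) / fact (2 * n + 1 + p)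
            * x ^ (2 * n + 1 + p)) sums tan_antideriv p x"
proof -
  define g where "g n = 2 * n + 1 + p" for n :: nat
  have "(\<lambda>i. tan_antideriv_coeff p i * x ^ i) sums tan_antideriv p x"
    unfolding tan_antideriv_def by (intro summable_sums tan_antideriv_summable assms)
  moreover have "strict_mono g" by (auto simp: g_def strict_mono_def)
  moreover have "tan_antideriv_coeff p i * x ^ i = 0" if "i \<notin> range g" for i
  proof -
    have "i < p \<or> even (i - p)"
    proof (rule ccontr)
      assume "\<not> (i < p \<or> even (i - p))"
      then obtain n where "i - p = 2 * n + 1" "i \<ge> p" using oddE by (metis not_less)
      then have "i = g n" by (simp add: g_def)
      then show False using that by blast
    qed
    then show ?thesis by (auto simp: tan_antideriv_coeff_def tan_coeff_def)
  qed
  ultimately have "(\<lambda>n. tan_antideriv_coeff p (g n) * x ^ g n) sums tan_antideriv p x"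
    by (subst sums_mono_reindex)
  then show ?thesis
    by (simp add: g_def tan_antideriv_coeff_def tan_coeff_def)
qed

lemma tan_antideriv_1:
  assumes "0 \<le> x" "x < 1/2" shows "tan_antideriv 1 x = - ln (cos (pi * x)) / 2"
proof -
  have "fact (2 * n + 1) / fact (2 * n + 1 + 1) = 1 / real (2 * Suc n)" for n
    by (simp add: divide_simps del: of_nat_Suc)
  then have "(\<lambda>n. zeta (real (2 * Suc n)) * (2 ^ (2 * Suc n) - 1) * fact (2 * n + 1) / fact (2 * n + 1 + 1)
            * x ^ (2 * n + 1 + 1)) =
      (\<lambda>n. zeta (real (2 * Suc n)) * (2 ^ (2 * Suc n) - 1) * x ^ (2 * Suc n) / real (2 * Suc n))"
    by (simp only: times_divide_eq_right[symmetric]) simp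
  with tan_antideriv_sums[of x 1] assms
  have "(\<lambda>n. zeta (real (2 * Suc n)) * (2 ^ (2 * Suc n) - 1) * x ^ (2 * Suc n) / real (2 * Suc n))
     sums tan_antideriv 1 x" by simp
  then show ?thesis using zeta_even_sums_ln_cos[OF assms] by (rule sums_unique2)
qed

section \<open>Iterated antiderivatives of the Fourier series\<close>

text \<open>
  Termwise antiderivatives of \<open>\<Sum>m\<ge>1. (-1) ^ m cos (2 \<pi> m x) / m\<close>, integrated \<open>q\<close> times: subtracting \<open>\<pi> / 2\<close>
  from the phase of a cosine yields an antiderivative, so one formula serves for sine and cosine
  levels alike. In contrast to \<open>tan_antideriv\<close>, these need not vanish at \<open>0\<close>.
\<close>
definition cos_antideriv :: "nat \<Rightarrow> real \<Rightarrow> real" where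
  "cos_antideriv q x = (\<Sum>m. (-1) ^ Suc m * cos (2 * pi * real (Suc m) * x - real q * pi / 2)
      / ((2 * pi) ^ q * real (Suc m) ^ Suc q))"

lemma cos_antideriv_term_bound:
  "\<bar>(-1) ^ Suc m * cos y / ((2 * pi) ^ q * real (Suc m) ^ Suc q)\<bar>
     \<le> 1 / real (Suc m) ^ Suc q"
proof -
  have "1 \<le> (2 * pi) ^ q" using pi_ge_two by (intro one_le_power) linarith
  then have "1 * real (Suc m) ^ Suc q \<le> (2 * pi) ^ q * real (Suc m) ^ Suc q"
    by (intro mult_right_mono) auto
  then have "\<bar>cos y\<bar> / ((2 * pi) ^ q * real (Suc m) ^ Suc q) \<le> 1 / (1 * real (Suc m) ^ Suc q)"
    by (intro frac_le) auto
  then show ?thesis by (simp add: abs_mult power_abs del: of_nat_Suc power_Suc)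
qed

lemma cos_antideriv_sums:
  assumes "q \<ge> 1"
  shows "(\<lambda>m. (-1) ^ Suc m * cos (2 * pi * real (Suc m) * x - real q * pi / 2)
      / ((2 * pi) ^ q * real (Suc m) ^ Suc q)) sums cos_antideriv q x"
  unfolding cos_antideriv_def
proof (rule summable_sums, rule summable_comparison_test'[of _ 0])
  show "summable (\<lambda>m. 1 / real (Suc m) ^ Suc q)"
    using assms by (intro summable_Suc_inverse_power) auto
qed (use cos_antideriv_term_bound in simp)

lemma cos_antideriv_has_derivative:
  assumes "q \<ge> 1"
  shows "(cos_antideriv (Suc q) has_real_derivative cos_antideriv q x) (at x)"
  unfolding cos_antideriv_def[abs_def]
proof (rule has_field_derivative_series'(2)[where S = UNIV and ?x0.0 = x and x = x])
  fix m :: nat and x :: real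
  have "cos (y - real (Suc q) * pi / 2) = sin (y - real q * pi / 2)"
    and sin_shift: "- sin (y - real (Suc q) * pi / 2) = cos (y - real q * pi / 2)" for y
  proof -
    have e: "y - real (Suc q) * pi / 2 = (y - real q * pi / 2) - pi / 2"
      by (simp add: field_simps)
    show "cos (y - real (Suc q) * pi / 2) = sin (y - real q * pi / 2)"
      "- sin (y - real (Suc q) * pi / 2) = cos (y - real q * pi / 2)"
      unfolding e by (simp_all add: cos_diff sin_diff)
  qed
  define a b where "a = 2 * pi * real (Suc m)" and "b = (2 * pi) ^ q * real (Suc m) ^ Suc q"
  have "a \<noteq> 0" "b \<noteq> 0" by (auto simp: a_def b_def simp del: of_nat_Suc)
  have ab: "(2 * pi) ^ Suc q * real (Suc m) ^ Suc (Suc q) = a * b" by (simp add: a_def b_def)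
  have "((\<lambda>x. (-1) ^ Suc m * cos (a * x - real (Suc q) * pi / 2) / (a * b)) has_real_derivative
     (-1) ^ Suc m * (- sin (a * x - real (Suc q) * pi / 2) * a) / (a * b)) (at x)"
    using \<open>a \<noteq> 0\<close> \<open>b \<noteq> 0\<close> by (auto intro!: derivative_eq_intros simp del: power_Suc of_nat_Suc)
  also have "(-1) ^ Suc m * (- sin (a * x - real (Suc q) * pi / 2) * a) / (a * b) =
     (-1) ^ Suc m * cos (a * x - real q * pi / 2) / b"
    unfolding sin_shift using \<open>a \<noteq> 0\<close> \<open>b \<noteq> 0\<close> by simp
  finally show "((\<lambda>x. (-1) ^ Suc m * cos (2 * pi * real (Suc m) * x - real (Suc q) * pi / 2)
      / ((2 * pi) ^ Suc q * real (Suc m) ^ Suc (Suc q))) has_real_derivative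
      (-1) ^ Suc m * cos (2 * pi * real (Suc m) * x - real q * pi / 2)
      / ((2 * pi) ^ q * real (Suc m) ^ Suc q)) (at x within UNIV)"
    unfolding ab by (simp add: a_def b_def)
next
  show "uniformly_convergent_on UNIV (\<lambda>n x. \<Sum>m<n. (-1) ^ Suc m *
      cos (2 * pi * real (Suc m) * x - real q * pi / 2) / ((2 * pi) ^ q * real (Suc m) ^ Suc q))"
  proof (rule Weierstrass_m_test'[where M = "\<lambda>m. 1 / real (Suc m) ^ Suc q"])
    show "summable (\<lambda>m. 1 / real (Suc m) ^ Suc q)"
      using assms by (intro summable_Suc_inverse_power) auto
  qed (use cos_antideriv_term_bound in simp)
next
  show "summable (\<lambda>m. (-1) ^ Suc m * cos (2 * pi * real (Suc m) * x - real (Suc q) * pi / 2)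
      / ((2 * pi) ^ Suc q * real (Suc m) ^ Suc (Suc q)))"
    using cos_antideriv_sums[of "Suc q"] by (simp add: sums_iff)
qed auto

text \<open>
  The real part of the series of \<open>ln (1 + z)\<close> at \<open>z = r exp (\<i> t)\<close>, negated.
\<close>
lemma abel_cos_sums:
  assumes "0 \<le> r" "r < 1"
  shows "(\<lambda>m. (-r) ^ Suc m * cos (real (Suc m) * t) / real (Suc m))
           sums (- ln (1 + 2 * r * cos t + r\<^sup>2) / 2)"
proof -
  define z where "z = complex_of_real r * cis t"
  have "norm z = r" using assms by (simp add: z_def norm_mult)
  then have nz: "norm z < 1" using assms by simp
  have ne: "1 + z \<noteq> 0"
  proof
    assume "1 + z = 0"
    then have "z = -1" by (simp add: add_eq_0_iff)
    then show False using nz by simp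
  qed
  have "(\<lambda>m. - ((-z) ^ m) / of_nat m) sums ln (1 + z)" using nz by (rule Ln_series')
  then have "(\<lambda>m. - ((-z) ^ Suc m) / of_nat (Suc m)) sums ln (1 + z)"
    by (subst sums_Suc_iff) simp
  then have "(\<lambda>m. Re (- ((-z) ^ Suc m) / of_nat (Suc m))) sums Re (ln (1 + z))"
    by (rule sums_Re)
  then have "(\<lambda>m. - Re (- ((-z) ^ Suc m) / of_nat (Suc m))) sums (- Re (ln (1 + z)))"
    by (rule sums_minus)
  moreover have "- Re (- ((-z) ^ Suc m) / of_nat (Suc m)) =
       (-r) ^ Suc m * cos (real (Suc m) * t) / real (Suc m)" for m
  proof -
    have "(-z) ^ Suc m = complex_of_real ((-r) ^ Suc m) * cis (real (Suc m) * t)"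
      unfolding z_def by (simp only: mult_minus_left[symmetric] power_mult_distrib Complex.DeMoivre of_real_power of_real_minus)
    then have "Re ((-z) ^ Suc m / of_nat (Suc m)) = (-r) ^ Suc m * cos (real (Suc m) * t) / real (Suc m)"
      by (simp only: Re_divide_of_nat Re_complex_of_real cis.simps times_complex.simps Im_complex_of_real) simp
    then show ?thesis by simp
  qed
  moreover have "Re (ln (1 + z)) = ln (1 + 2 * r * cos t + r\<^sup>2) / 2"
  proof -
    have "(norm (1 + z))\<^sup>2 = (1 + r * cos t)\<^sup>2 + (r * sin t)\<^sup>2"
      by (simp add: cmod_power2 z_def)
    also have "\<dots> = 1 + 2 * r * cos t + r\<^sup>2 * ((sin t)\<^sup>2 + (cos t)\<^sup>2)"
      unfolding power2_eq_square by algebra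
    finally have "1 + 2 * r * cos t + r\<^sup>2 = (norm (1 + z))\<^sup>2" by simp
    then show ?thesis using ne by (simp add: ln_realpow)
  qed
  ultimately show ?thesis by simp
qed

text \<open>
  The level \<open>q = 1\<close> with damping factors \<open>r ^ m\<close>; for \<open>r < 1\<close> it may be differentiated termwise.
\<close>
definition abel_sin :: "real \<Rightarrow> real \<Rightarrow> real" where
  "abel_sin r x = (\<Sum>m. (-r) ^ Suc m * sin (2 * pi * real (Suc m) * x) / (2 * pi * real (Suc m) ^ 2))"

lemma abel_sin_term_bound:
  assumes "0 \<le> r" "r \<le> 1"
  shows "\<bar>(-r) ^ Suc m * sin y / (2 * pi * real (Suc m) ^ 2)\<bar> \<le> 1 / real (Suc m) ^ 2"
proof -
  have "\<bar>(-r) ^ Suc m * sin y\<bar> \<le> 1 * 1" unfolding abs_mult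
    using assms by (intro mult_mono) (auto simp: power_abs power_le_one simp del: power_Suc)
  moreover have "1 * real (Suc m) ^ 2 \<le> 2 * pi * real (Suc m) ^ 2"
    using pi_ge_two by (intro mult_right_mono) auto
  ultimately have "\<bar>(-r) ^ Suc m * sin y\<bar> / (2 * pi * real (Suc m) ^ 2) \<le> 1 / (1 * real (Suc m) ^ 2)"
    by (intro frac_le) auto
  then show ?thesis by (simp del: of_nat_Suc power_Suc)
qed

lemma abel_sin_1: "abel_sin 1 x = cos_antideriv 1 x"
  unfolding abel_sin_def cos_antideriv_def by (simp add: cos_diff power2_eq_square)

lemma abel_sin_has_derivative:
  assumes r: "0 \<le> r" "r < 1"
  shows "(abel_sin r has_real_derivative - ln (1 + 2 * r * cos (2 * pi * x) + r\<^sup>2) / 2) (at x)"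
proof -
  have "((\<lambda>x. \<Sum>m. (-r) ^ Suc m * sin (2 * pi * real (Suc m) * x) / (2 * pi * real (Suc m) ^ 2))
     has_real_derivative (\<Sum>m. (-r) ^ Suc m * cos (real (Suc m) * (2 * pi * x)) / real (Suc m))) (at x)"
  proof (rule has_field_derivative_series'(2)[where S = UNIV and ?x0.0 = 0 and x = x
      and f' = "\<lambda>m x. (-r) ^ Suc m * cos (real (Suc m) * (2 * pi * x)) / real (Suc m)"])
    fix m :: nat and x :: real
    define a where "a = real (Suc m)"
    have "a \<noteq> 0" by (simp add: a_def)
    have "((\<lambda>x. sin (2 * pi * a * x)) has_real_derivative cos (2 * pi * a * x) * (2 * pi * a)) (at x)"
      by (auto intro!: derivative_eq_intros)
    from DERIV_cdivide[OF DERIV_cmult[OF this]]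
    have "((\<lambda>x. (-r) ^ Suc m * sin (2 * pi * a * x) / (2 * pi * a ^ 2)) has_real_derivative
        (-r) ^ Suc m * (cos (2 * pi * a * x) * (2 * pi * a)) / (2 * pi * a ^ 2)) (at x)" .
    also have "(-r) ^ Suc m * (cos (2 * pi * a * x) * (2 * pi * a)) / (2 * pi * a ^ 2) =
        (-r) ^ Suc m * cos (a * (2 * pi * x)) / a"
      using \<open>a \<noteq> 0\<close> by (simp add: power2_eq_square mult_ac)
    finally show "((\<lambda>x. (-r) ^ Suc m * sin (2 * pi * real (Suc m) * x) / (2 * pi * real (Suc m) ^ 2))
      has_real_derivative (-r) ^ Suc m * cos (real (Suc m) * (2 * pi * x)) / real (Suc m)) (at x within UNIV)"
      by (simp add: a_def)
  next
    show "uniformly_convergent_on UNIV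
      (\<lambda>n x. \<Sum>m<n. (-r) ^ Suc m * cos (real (Suc m) * (2 * pi * x)) / real (Suc m))"
    proof (rule Weierstrass_m_test'[where M = "\<lambda>m. r ^ m"])
      show "summable (\<lambda>m. r ^ m)" using r by (intro summable_geometric) auto
      fix m :: nat and x :: real
      have "\<bar>(-r) ^ Suc m * cos (real (Suc m) * (2 * pi * x))\<bar> \<le> r ^ m * 1" unfolding abs_mult
        using r by (intro mult_mono) (auto simp: power_abs abs_mult mult_left_le_one_le)
      then have "\<bar>(-r) ^ Suc m * cos (real (Suc m) * (2 * pi * x))\<bar> / real (Suc m) \<le> (r ^ m * 1) / 1"
        using r by (intro frac_le) auto
      then show "norm ((-r) ^ Suc m * cos (real (Suc m) * (2 * pi * x)) / real (Suc m)) \<le> r ^ m"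
        by (simp del: of_nat_Suc power_Suc)
    qed
  qed auto
  then show ?thesis
    using abel_cos_sums[OF r, of "2 * pi * x"] by (simp add: abel_sin_def[abs_def] sums_iff)
qed

lemma cos_pi_mult_pos:
  assumes "\<bar>x\<bar> < 1/2" shows "cos (pi * x) > 0"
proof -
  have "pi * x < pi * (1/2)" "pi * (-1/2) < pi * x"
    using assms by (intro mult_strict_left_mono; simp add: abs_less_iff)+
  then show ?thesis by (intro cos_gt_zero_pi) simp_all
qed

text \<open>
  The termwise derivative of \<open>cos_antideriv 1\<close> converges only conditionally, which rules out a
  comparison test. Instead the damped functions \<open>abel_sin r\<close> are used: as \<open>r\<close> tends to \<open>1\<close> from
  below, they converge to \<open>cos_antideriv 1\<close> by dominated convergence, and their derivatives, known in
  closed form, converge uniformly on \<open>[0, 1/4]\<close>. The interval matters: there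
  \<open>cos (2 \<pi> x) \<ge> 0\<close>, so the arguments of the logarithms are at least \<open>1\<close>.
\<close>
lemma cos_antideriv_1_has_derivative:
  assumes x: "x \<in> {0..1/4}"
  shows "(cos_antideriv 1 has_real_derivative - ln (2 * cos (pi * x))) (at x within {0..1/4})"
proof -
  define r where "r n = 1 - 1 / real (Suc n)" for n
  have r: "0 \<le> r n" "r n < 1" for n by (auto simp: r_def field_simps)
  have r_lim: "r \<longlonglongrightarrow> 1"
  proof -
    have "(\<lambda>n. 1 - 1 / real (Suc n)) \<longlonglongrightarrow> 1 - 0"
      by (intro tendsto_intros LIMSEQ_Suc[OF lim_1_over_n])
    then show ?thesis by (simp add: r_def[abs_def])
  qed
  define d where "d n y = - ln (1 + 2 * r n * cos (2 * pi * y) + (r n)\<^sup>2) / 2" for n y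
  define d' where "d' y = - ln (2 + 2 * cos (2 * pi * y)) / 2" for y
  \<comment> \<open>The logarithm has slope at most \<open>1\<close> on \<open>[1, \<infinity>)\<close>, and the two arguments differ by at most \<open>4 (1 - r n)\<close>.\<close>
  have close: "\<bar>d n y - d' y\<bar> \<le> 2 * (1 - r n)" if y: "y \<in> {0..1/4}" for n y
  proof -
    let ?c = "cos (2 * pi * y)"
    have c: "0 \<le> ?c" "?c \<le> 1" using y by (auto intro!: cos_ge_zero intro: order_trans[of _ 0])
    define u v where "u = 1 + 2 * r n * ?c + (r n)\<^sup>2" and "v = 2 + 2 * ?c"
    have u: "u \<ge> 1" using r c by (simp add: u_def)
    have "(1 - r n) * (2 * ?c + 1 + r n) = v - u"
      by (simp add: u_def v_def power2_eq_square algebra_simps)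
    moreover have "(1 - r n) * (2 * ?c + 1 + r n) \<le> (1 - r n) * 4"
      using r[of n] c by (intro mult_left_mono) linarith+
    moreover have "(1 - r n) * (2 * ?c + 1 + r n) \<ge> 0"
      using r[of n] c by (intro mult_nonneg_nonneg) linarith+
    ultimately have vu: "0 \<le> v - u" "v - u \<le> 4 * (1 - r n)" by linarith+
    have "ln v - ln u \<le> (v - u) / u" using u vu by (intro ln_diff_le) auto
    also have "\<dots> \<le> v - u" using u vu divide_left_mono[of 1 u "v - u"] by simp
    finally have "ln v - ln u \<le> 4 * (1 - r n)" using vu by linarith
    moreover have "ln u \<le> ln v" using u vu by simp
    ultimately show ?thesis by (simp add: d_def d'_def u_def[symmetric] v_def[symmetric])
  qed
  have "\<exists>g. \<forall>y\<in>{0..1/4}. (\<lambda>n. abel_sin (r n) y) \<longlonglongrightarrow> g y \<and>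
          (g has_derivative (\<lambda>h. d' y * h)) (at y within {0..1/4})"
  proof (rule has_derivative_sequence[where ?x0.0 = 0 and l = 0 and f' = "\<lambda>n y h. d n y * h"])
    fix n y
    show "(abel_sin (r n) has_derivative (*) (d n y)) (at y within {0..1/4})"
      using abel_sin_has_derivative[OF r[of n], of y, THEN has_field_derivative_at_within]
      by (simp add: d_def has_field_derivative_def)
  next
    fix e :: real assume "e > 0"
    have "(\<lambda>n. 2 * (1 - r n)) \<longlonglongrightarrow> 2 * (1 - 1)" by (intro tendsto_intros r_lim)
    then have "eventually (\<lambda>n. 2 * (1 - r n) < e) sequentially"
      using \<open>e > 0\<close> by (intro order_tendstoD) auto
    then show "\<forall>\<^sub>F n in sequentially. \<forall>y\<in>{0..1/4}. \<forall>h. norm (d n y * h - d' y * h) \<le> e * norm h"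
    proof eventually_elim
      case (elim n)
      show ?case
      proof (intro ballI allI)
        fix y h :: real assume "y \<in> {0..1/4}"
        then have "\<bar>d n y - d' y\<bar> \<le> e" using close[of y n] elim by linarith
        then show "norm (d n y * h - d' y * h) \<le> e * norm h"
          by (simp add: left_diff_distrib[symmetric] abs_mult mult_right_mono)
      qed
    qed
  next
    show "(\<lambda>n. abel_sin (r n) 0) \<longlonglongrightarrow> 0" by (simp add: abel_sin_def)
  qed auto
  then obtain g where "\<forall>y\<in>{0..1/4}. (\<lambda>n. abel_sin (r n) y) \<longlonglongrightarrow> g y \<and>
      (g has_derivative (\<lambda>h. d' y * h)) (at y within {0..1/4})" by blast
  then have g: "\<And>y. y \<in> {0..1/4} \<Longrightarrow> (\<lambda>n. abel_sin (r n) y) \<longlonglongrightarrow> g y"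
      "\<And>y. y \<in> {0..1/4} \<Longrightarrow> (g has_real_derivative d' y) (at y within {0..1/4})"
    by (auto simp: has_field_derivative_def)
  have lim: "(\<lambda>n. abel_sin (r n) y) \<longlonglongrightarrow> abel_sin 1 y" for y
    unfolding abel_sin_def
  proof (rule tannerys_theorem[where M = "\<lambda>m. 1 / real (Suc m) ^ 2", THEN conjunct2, THEN conjunct2])
    fix m
    show "(\<lambda>n. (- r n) ^ Suc m * sin (2 * pi * real (Suc m) * y) / (2 * pi * (real (Suc m))\<^sup>2))
      \<longlonglongrightarrow> (- 1) ^ Suc m * sin (2 * pi * real (Suc m) * y) / (2 * pi * (real (Suc m))\<^sup>2)"
      by (intro tendsto_intros r_lim) auto
    show "\<forall>\<^sub>F (m, n) in sequentially \<times>\<^sub>F sequentially.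
       norm ((- r n) ^ Suc m * sin (2 * pi * real (Suc m) * y) / (2 * pi * (real (Suc m))\<^sup>2))
       \<le> 1 / (real (Suc m))\<^sup>2"
      using abel_sin_term_bound[OF r(1) less_imp_le[OF r(2)]]
      by (intro always_eventually) auto
  qed (auto intro: summable_Suc_inverse_power simp del: of_nat_Suc)
  have "g y = cos_antideriv 1 y" if "y \<in> {0..1/4}" for y
    using LIMSEQ_unique[OF g(1)[OF that] lim] abel_sin_1 by simp
  then have "(cos_antideriv 1 has_real_derivative d' x) (at x within {0..1/4})"
    by (rule has_field_derivative_transform_within[OF g(2)[OF x] zero_less_one x])
  moreover have "d' x = - ln (2 * cos (pi * x))"
  proof -
    have "cos (pi * x) > 0" using x by (intro cos_pi_mult_pos) auto
    then have ln_square: "ln ((2 * cos (pi * x))\<^sup>2) = real 2 * ln (2 * cos (pi * x))"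
      by (intro ln_realpow)
    have double: "2 + 2 * cos (2 * pi * x) = (2 * cos (pi * x))\<^sup>2"
      using cos_double_cos[of "pi * x"] by (simp add: power_mult_distrib mult.assoc)
    show ?thesis unfolding d'_def double ln_square by simp
  qed
  ultimately show ?thesis by simp
qed

section \<open>Comparing the two families\<close>

text \<open>
  Taylor's formula without remainder, since the bottom level is constant: \<open>U q\<close> and the polynomial have
  the same derivative by induction and the same value at \<open>0\<close>.
\<close>
lemma antiderivative_ladder_polynomial:
  fixes U :: "nat \<Rightarrow> real \<Rightarrow> real"
  assumes S: "convex S" "0 \<in> S"
    and const: "\<And>x. x \<in> S \<Longrightarrow> U 0 x = U 0 0"
    and deriv: "\<And>q x. x \<in> S \<Longrightarrow> (U (Suc q) has_real_derivative U q x) (at x within S)"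
    and x: "x \<in> S"
  shows "U q x = (\<Sum>i\<le>q. U i 0 * x ^ (q - i) / fact (q - i))"
  using x
proof (induction q arbitrary: x)
  case 0
  then show ?case using const[of x] by simp
next
  case (Suc q)
  define T where "T x = (\<Sum>i\<le>q. U i 0 * x ^ (Suc q - i) / fact (Suc q - i))" for x
  have T: "(T has_real_derivative U q y) (at y within S)" if y: "y \<in> S" for y
  proof -
    have "((\<lambda>x. U i 0 * x ^ (Suc q - i) / fact (Suc q - i)) has_real_derivative
          U i 0 * y ^ (q - i) / fact (q - i)) (at y within S)" if "i \<le> q" for i
    proof -
      have "real (Suc (q - i)) / fact (Suc (q - i)) = 1 / fact (q - i)"
        by (simp add: divide_simps)
      then have "U i 0 * (real (Suc (q - i)) * y ^ (q - i)) / fact (Suc (q - i)) = U i 0 * y ^ (q - i) / fact (q - i)"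
        by (simp add: divide_simps del: of_nat_Suc)
      moreover have "((\<lambda>x. U i 0 * x ^ Suc (q - i) / fact (Suc (q - i))) has_real_derivative
          U i 0 * (real (Suc (q - i)) * y ^ (q - i)) / fact (Suc (q - i))) (at y within S)"
        by (intro DERIV_cdivide DERIV_cmult) (use DERIV_power[of "\<lambda>x. x" 1 y S "Suc (q-i)"] in \<open>simp add: mult.commute\<close>)
      ultimately show ?thesis using that by (simp add: Suc_diff_le del: power_Suc fact_Suc of_nat_Suc)
    qed
    then show ?thesis unfolding T_def Suc.IH[OF y]
      by (intro DERIV_sum) auto
  qed
  have "((\<lambda>x. U (Suc q) x - T x) has_derivative (\<lambda>h. 0)) (at y within S)" if "y \<in> S" for y
    using DERIV_diff[OF deriv[OF that, of q] T[OF that]]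
    by (simp add: has_field_derivative_def lambda_zero)
  then have "U (Suc q) x - T x = U (Suc q) 0 - T 0"
    using S Suc.prems by (intro has_derivative_zero_unique[where s = S and f = "\<lambda>x. U (Suc q) x - T x"]) auto
  moreover have "T 0 = 0" by (auto simp: T_def intro!: sum.neutral)
  ultimately show ?case by (simp add: T_def)
qed

text \<open>
  At \<open>x = 0\<close> all terms of the Fourier series share the factor \<open>cos (q \<pi> / 2)\<close>; what remains is an
  alternating zeta series.
\<close>
lemma cos_antideriv_odd_0: "odd q \<Longrightarrow> cos_antideriv q 0 = 0"
proof -
  assume "odd q"
  then obtain m where "q = 2 * m + 1" by (elim oddE)
  then have "real q * pi / 2 = real m * pi + pi / 2" by (simp add: field_simps)
  then have "cos (real q * pi / 2) = 0" by (simp only:) (simp add: cos_add)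
  then show ?thesis by (simp add: cos_antideriv_def)
qed

lemma cos_antideriv_even_0:
  assumes "m \<ge> 1"
  shows "cos_antideriv (2 * m) 0
           = - ((-1) ^ m * ((2 ^ (2 * m) - 1) / (4 ^ (2 * m) * pi ^ (2 * m))) * zeta (real (2 * m + 1)))"
proof -
  have s1: "(\<lambda>n. (-1) ^ Suc n * cos (2 * pi * real (Suc n) * 0 - real (2 * m) * pi / 2)
      / ((2 * pi) ^ (2 * m) * real (Suc n) ^ Suc (2 * m))) sums cos_antideriv (2 * m) 0"
    using assms by (intro cos_antideriv_sums) auto
  have eq: "(\<lambda>n. (-1) ^ Suc n * cos (2 * pi * real (Suc n) * 0 - real (2 * m) * pi / 2)
      / ((2 * pi) ^ (2 * m) * real (Suc n) ^ Suc (2 * m))) =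
    (\<lambda>n. - ((-1) ^ m / (2 * pi) ^ (2 * m)) * ((-1) ^ n / real (Suc n) ^ (2 * m + 1)))"
    by (simp add: mult.commute)
  have s2: "(\<lambda>n. - ((-1) ^ m / (2 * pi) ^ (2 * m)) * ((-1) ^ n / real (Suc n) ^ (2 * m + 1))) sums
    (- ((-1) ^ m / (2 * pi) ^ (2 * m)) * ((1 - 2 / 2 ^ (2 * m + 1)) * zeta (real (2 * m + 1))))"
    using assms by (intro sums_mult alternating_zeta_sums) auto
  have "cos_antideriv (2 * m) 0 =
      - ((-1) ^ m / (2 * pi) ^ (2 * m)) * ((1 - 2 / 2 ^ (2 * m + 1)) * zeta (real (2 * m + 1)))"
    by (rule sums_unique2[OF s1[unfolded eq] s2])
  moreover have "(4::real) ^ (2 * m) = 2 ^ (2 * m) * 2 ^ (2 * m)"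
    by (simp add: power_mult_distrib[symmetric])
  ultimately show ?thesis
    by (simp add: power_mult_distrib field_simps)
qed

text \<open>
  With \<open>q = 2k - 1\<close> and \<open>m\<close>-th phase \<open>m \<pi> / 2 - (2k - 1) \<pi> / 2\<close>, the cosine vanishes for even \<open>m\<close> and
  alternates in sign over odd \<open>m\<close>, which is the pattern of the beta series.
\<close>
lemma cos_antideriv_odd_quarter:
  assumes "k \<ge> 1"
  shows "cos_antideriv (2 * k - 1) (1/4) = (-1) ^ k * dirichlet_beta (real (2 * k)) / (2 * pi) ^ (2 * k - 1)"
proof -
  have k: "Suc (2 * k - 1) = 2 * k" "real (2 * k - 1) = 2 * real k - 1" using assms by auto
  define f where "f n = (-1) ^ Suc n * cos (2 * pi * real (Suc n) * (1/4) - real (2 * k - 1) * pi / 2)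
      / ((2 * pi) ^ (2 * k - 1) * real (Suc n) ^ (2 * k))" for n
  have f: "f sums cos_antideriv (2 * k - 1) (1/4)"
    using cos_antideriv_sums[of "2 * k - 1" "1/4"] assms unfolding f_def k(1) by simp
  have cos_eq: "cos (2 * pi * real (Suc n) * (1/4) - real (2 * k - 1) * pi / 2)
        = (-1) ^ k * cos (real n * pi / 2 + pi)" for n
  proof -
    have "2 * pi * real (Suc n) * (1/4) - real (2 * k - 1) * pi / 2 = real n * pi / 2 + pi - real k * pi"
      unfolding k(2) by (simp add: field_simps)
    then show ?thesis by (simp add: cos_diff)
  qed
  have "f n = 0" if "n \<notin> range (\<lambda>j. 2 * j)" for n
  proof -
    have "odd n" using that by (metis evenE rangeI)
    then obtain j where "n = 2 * j + 1" by (elim oddE)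
    then have "real n * pi / 2 = real j * pi + pi / 2" by (simp add: field_simps)
    then have "cos (real n * pi / 2) = 0" by (simp only:) (simp add: cos_add)
    then have "cos (real n * pi / 2 + pi) = 0" by simp
    then show ?thesis unfolding f_def cos_eq by (simp only: mult_zero_right div_0)
  qed
  then have s1: "(\<lambda>j. f (2 * j)) sums cos_antideriv (2 * k - 1) (1/4)"
    using f by (subst sums_mono_reindex) (auto simp: strict_mono_def)
  have eq: "(\<lambda>j. f (2 * j)) = (\<lambda>j. (-1) ^ k / (2 * pi) ^ (2 * k - 1) * ((-1) ^ j / real (2 * j + 1) ^ (2 * k)))"
    unfolding f_def cos_eq by simp
  have s2: "(\<lambda>j. (-1) ^ k / (2 * pi) ^ (2 * k - 1) * ((-1) ^ j / real (2 * j + 1) ^ (2 * k)))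
      sums ((-1) ^ k / (2 * pi) ^ (2 * k - 1) * dirichlet_beta (real (2 * k)))"
    using assms by (intro sums_mult dirichlet_beta_sums) auto
  have "cos_antideriv (2 * k - 1) (1/4) = (-1) ^ k / (2 * pi) ^ (2 * k - 1) * dirichlet_beta (real (2 * k))"
    by (rule sums_unique2[OF s1[unfolded eq] s2])
  then show ?thesis by simp
qed

text \<open>
  The differences of the two families satisfy the hypotheses of
  \<open>antiderivative_ladder_polynomial\<close>, with the constant
  \<open>- ln (cos (\<pi> x)) / 2 + ln (2 cos (\<pi> x)) / 2 = ln 2 / 2\<close> as bottom level.
\<close>
lemma tan_antideriv_eq_cos_antideriv:
  assumes x: "x \<in> {0..1/4}" and q: "q \<ge> 1"
  shows "tan_antideriv (Suc q) x = cos_antideriv q x / 2 + ln 2 / 2 * x ^ q / fact q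
           - (\<Sum>i = 1..q. cos_antideriv i 0 * x ^ (q - i) / fact (q - i)) / 2"
proof -
  \<comment> \<open>Level \<open>0\<close> is given in closed form, because the Fourier series of that level converges only
    conditionally.\<close>
  define U where "U q x = (if q = 0 then ln 2 / 2 else tan_antideriv (Suc q) x - cos_antideriv q x / 2)"
    for q :: nat and x :: real
  have deriv: "(U (Suc j) has_real_derivative U j y) (at y within {0..1/4})" if y: "y \<in> {0..1/4}" for j y
  proof -
    have A: "(tan_antideriv (Suc (Suc j)) has_real_derivative tan_antideriv (Suc j) y) (at y within {0..1/4})"
      using y by (intro has_field_derivative_at_within[OF tan_antideriv_has_derivative]) auto
    have U: "U (Suc j) = (\<lambda>y. tan_antideriv (Suc (Suc j)) y - cos_antideriv (Suc j) y / 2)"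
      by (rule ext) (simp add: U_def)
    show ?thesis
    proof (cases "j = 0")
      case True
      have "cos (pi * y) > 0" using y by (intro cos_pi_mult_pos) auto
      then have start: "tan_antideriv (Suc 0) y - (- ln (2 * cos (pi * y))) / 2 = U j y"
        using tan_antideriv_1[of y] y True by (simp add: U_def ln_mult field_simps)
      show ?thesis
        using DERIV_diff[OF A DERIV_cdivide[OF cos_antideriv_1_has_derivative[OF y], of 2]]
        unfolding U by (simp only: True One_nat_def start[unfolded True])
    next
      case False
      then have "(cos_antideriv (Suc j) has_real_derivative cos_antideriv j y) (at y within {0..1/4})"
        by (intro has_field_derivative_at_within[OF cos_antideriv_has_derivative]) auto
      from DERIV_diff[OF A DERIV_cdivide[OF this, of 2]] show ?thesis
        unfolding U using False by (simp add: U_def)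
    qed
  qed
  have "U q x = (\<Sum>i\<le>q. U i 0 * x ^ (q - i) / fact (q - i))"
  proof (rule antiderivative_ladder_polynomial[where S = "{0..1/4}" and U = U])
    show "U 0 y = U 0 0" for y by (simp add: U_def)
  qed (use deriv x in auto)
  also have "\<dots> = U 0 0 * x ^ q / fact q + (\<Sum>i = 1..q. U i 0 * x ^ (q - i) / fact (q - i))"
    by (simp add: atMost_atLeast0 sum.atLeast_Suc_atMost)
  also have "(\<Sum>i = 1..q. U i 0 * x ^ (q - i) / fact (q - i)) =
      (\<Sum>i = 1..q. - (cos_antideriv i 0 * x ^ (q - i) / fact (q - i)) / 2)"
    by (intro sum.cong) (auto simp: U_def tan_antideriv_0)
  also have "\<dots> = - (\<Sum>i = 1..q. cos_antideriv i 0 * x ^ (q - i) / fact (q - i)) / 2"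
    by (simp only: sum_divide_distrib[symmetric] sum_negf)
  finally show ?thesis using q by (simp add: U_def algebra_simps)
qed

section \<open>Evaluation at one quarter\<close>

lemma prod_eq_fact_quotient:
  assumes "a \<ge> 1" "a \<le> b"
  shows "(\<Prod>j = a..b. real j) = fact b / fact (a - 1)"
  using assms(2)
proof (induction b rule: dec_induct)
  case base
  then show ?case using assms(1) by (cases a) simp_all
next
  case (step b)
  then show ?case by (simp add: prod.atLeastAtMost_shift_bounds divide_simps)
qed

lemma sum_even_indices:
  fixes f :: "nat \<Rightarrow> real"
  assumes "\<And>i. odd i \<Longrightarrow> f i = 0" and "k \<ge> 1"
  shows "(\<Sum>i = 1..2 * k - 1. f i) = (\<Sum>m = 1..k - 1. f (2 * m))"
proof -
  have "(\<Sum>m = 1..k - 1. f (2 * m)) = (\<Sum>i \<in> (\<lambda>m. 2 * m) ` {1..k - 1}. f i)"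
    by (subst sum.reindex) (auto simp: inj_on_def)
  also have "\<dots> = (\<Sum>i = 1..2 * k - 1. f i)"
  proof (rule sum.mono_neutral_left)
    show "\<forall>i \<in> {1..2 * k - 1} - (\<lambda>m. 2 * m) ` {1..k - 1}. f i = 0"
    proof
      fix i assume i: "i \<in> {1..2 * k - 1} - (\<lambda>m. 2 * m) ` {1..k - 1}"
      have "odd i"
      proof
        assume "even i"
        then obtain m where "i = 2 * m" by (elim evenE)
        with i show False by auto
      qed
      then show "f i = 0" by (rule assms(1))
    qed
  qed auto
  finally show ?thesis by simp
qed

theorem theorem2:
  fixes k :: nat
  assumes "k \<ge> 1"
  shows "(\<lambda>i. let n = Suc i in
            zeta (real (2 * n)) / (\<Prod>j = 2 * n..2 * n + 2 * k - 1. real j)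
              * (1 / 2 ^ (2 * n) - 1 / 4 ^ (2 * n)))
         sums
         ((-1) ^ k * (2 ^ (2 * k - 2) / pi ^ (2 * k - 1)) * dirichlet_beta (real (2 * k))
          + real k / fact (2 * k) * ln 2
          + 1 / 2 * (\<Sum>m = 1..k - 1. (-1) ^ m * ((2 ^ (2 * m) - 1) / pi ^ (2 * m))
              * (zeta (real (2 * m + 1)) / fact (2 * k - 2 * m - 1))))"
proof -
  define q where "q = 2 * k - 1"
  have q: "q \<ge> 1" "Suc q = 2 * k" using assms by (auto simp: q_def)
  \<comment> \<open>The factor \<open>4 ^ q\<close> turns the power \<open>(1/4) ^ (2n + q)\<close>, for \<open>n \<ge> 1\<close>, into \<open>(1/4) ^ (2n)\<close>, and
    \<open>(2 ^ (2n) - 1) / 4 ^ (2n) = 1 / 2 ^ (2n) - 1 / 4 ^ (2n)\<close>.\<close>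
  have lhs: "(\<lambda>n. 4 ^ q * (zeta (real (2 * Suc n)) * (2 ^ (2 * Suc n) - 1) * fact (2 * n + 1)
       / fact (2 * n + 1 + Suc q) * (1/4) ^ (2 * n + 1 + Suc q))) sums (4 ^ q * tan_antideriv (Suc q) (1/4))"
    by (intro sums_mult tan_antideriv_sums) simp
  have summand: "4 ^ q * (zeta (real (2 * Suc i)) * (2 ^ (2 * Suc i) - 1) * fact (2 * i + 1)
       / fact (2 * i + 1 + Suc q) * (1/4) ^ (2 * i + 1 + Suc q)) =
     (let n = Suc i in zeta (real (2 * n)) / (\<Prod>j = 2 * n..2 * n + 2 * k - 1. real j)
              * (1 / 2 ^ (2 * n) - 1 / 4 ^ (2 * n)))" for i
  proof -
    have p1: "(\<Prod>j = 2 * Suc i..2 * Suc i + 2 * k - 1. real j) = fact (2 * i + 1 + Suc q) / fact (2 * i + 1)"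
      using prod_eq_fact_quotient[of "2 * Suc i" "2 * Suc i + 2 * k - 1"] q by simp
    have p2: "(4::real) ^ q * (1/4) ^ (2 * i + 1 + Suc q) = 1 / 4 ^ (2 * Suc i)"
      by (simp add: power_add power_divide)
    have p3: "(1::real) / 2 ^ (2 * Suc i) - 1 / 4 ^ (2 * Suc i) = (2 ^ (2 * Suc i) - 1) * (1 / 4 ^ (2 * Suc i))"
    proof -
      have "(4::real) ^ (2 * Suc i) = 2 ^ (2 * Suc i) * 2 ^ (2 * Suc i)"
        by (simp only: power_mult_distrib[symmetric]) simp
      then show ?thesis by (simp add: divide_simps)
    qed
    have rearrange: "a * (z * b * c / d * e) = z / (d / c) * (b * (a * e))" if "c \<noteq> 0" for a z b c d e :: real
      using that by simp
    show ?thesis unfolding Let_def p1 p3 unfolding p2[symmetric] by (rule rearrange[OF fact_nonzero])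
  qed
  have beta: "4 ^ q * (cos_antideriv q (1/4) / 2) =
      (-1) ^ k * (2 ^ (2 * k - 2) / pi ^ (2 * k - 1)) * dirichlet_beta (real (2 * k))"
  proof -
    have "(4::real) ^ q = 2 ^ q * 2 ^ q" by (simp only: power_mult_distrib[symmetric]) simp
    moreover have "(2::real) ^ q = 2 * 2 ^ (2 * k - 2)"
      using q(2) assms by (subst power_Suc[symmetric]) (rule arg_cong[of _ _ "power 2"], simp add: q_def)
    ultimately show ?thesis
      unfolding cos_antideriv_odd_quarter[OF assms, folded q_def] q_def[symmetric] power_mult_distrib
      by simp
  qed
  have log: "4 ^ q * (ln 2 / 2 * (1/4) ^ q / fact q) = real k / fact (2 * k) * ln 2"
  proof -
    have "fact (2 * k) = 2 * real k * fact q" unfolding q(2)[symmetric] fact_Suc using q(2) by simp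
    then show ?thesis using assms by (simp add: power_divide)
  qed
  \<comment> \<open>In the Taylor polynomial only the even levels \<open>i = 2 * m\<close> survive, and they carry the odd zeta values.\<close>
  define h where "h i = 4 ^ q * (cos_antideriv i 0 * (1/4) ^ (q - i) / fact (q - i))" for i
  have h: "h (2 * m) = - ((-1) ^ m * ((2 ^ (2 * m) - 1) / pi ^ (2 * m))
              * (zeta (real (2 * m + 1)) / fact (2 * k - 2 * m - 1)))" if m: "m \<in> {1..k - 1}" for m
  proof -
    have "q = (q - 2 * m) + 2 * m" using m by (auto simp: q_def)
    then have "(4::real) ^ q = 4 ^ (q - 2 * m) * 4 ^ (2 * m)" by (metis power_add)
    then have "(4::real) ^ q * (1/4) ^ (q - 2 * m) = 4 ^ (2 * m)" by (simp add: power_divide)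
    moreover have "q - 2 * m = 2 * k - 2 * m - 1" by (simp add: q_def)
    ultimately have "h (2 * m) = 4 ^ (2 * m) * cos_antideriv (2 * m) 0 / fact (2 * k - 2 * m - 1)"
      by (simp add: h_def)
    then show ?thesis using m cos_antideriv_even_0[of m] by simp
  qed
  have "4 ^ q * (\<Sum>i = 1..q. cos_antideriv i 0 * (1/4) ^ (q - i) / fact (q - i)) = (\<Sum>i = 1..2 * k - 1. h i)"
    by (simp add: h_def sum_distrib_left q_def)
  also have "\<dots> = (\<Sum>m = 1..k - 1. h (2 * m))"
    by (rule sum_even_indices[OF _ assms]) (simp add: h_def cos_antideriv_odd_0)
  also have "\<dots> = - (\<Sum>m = 1..k - 1. (-1) ^ m * ((2 ^ (2 * m) - 1) / pi ^ (2 * m))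
              * (zeta (real (2 * m + 1)) / fact (2 * k - 2 * m - 1)))"
    unfolding sum_negf[symmetric] by (intro sum.cong refl h)
  finally have zeta_part: "4 ^ q * (\<Sum>i = 1..q. cos_antideriv i 0 * (1/4) ^ (q - i) / fact (q - i)) = \<dots>" .
  have "4 ^ q * tan_antideriv (Suc q) (1/4) = 4 ^ q * (cos_antideriv q (1/4) / 2)
      + 4 ^ q * (ln 2 / 2 * (1/4) ^ q / fact q)
      - 4 ^ q * (\<Sum>i = 1..q. cos_antideriv i 0 * (1/4) ^ (q - i) / fact (q - i)) / 2"
    unfolding distrib_left[symmetric] right_diff_distrib[symmetric] times_divide_eq_right[symmetric]
    using tan_antideriv_eq_cos_antideriv[of "1/4" q] q(1) by simp
  with lhs show ?thesis
    unfolding summand beta log zeta_part by simp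
qed

end
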